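(* Let $Q\subseteq\mathbb{R}^n$ be open, $N\ge1$, and let $S_{\rm d}^{k}:Q\to\mathbb{R}$, $k=0,\dots,N$, be smooth functions. (1) Let $H_{\rm d}^{+}$ be a right discrete Hamiltonian and suppose that $\{S_{\rm d}^k\}$ satisfies the right discrete Hamilton--Jacobi equation: for all $k=0,\dots,N-1$ and $q\in Q$, $$S_{\rm d}^{k+1}(f^{+}_{k}(q))-S_{\rm d}^{k}(q)-DS_{\rm d}^{k+1}(f^{+}_{k}(q))\cdot f^{+}_{k}(q)+H_{\rm d}^{+}\big(q,DS_{\rm d}^{k+1}(f^{+}_{k}(q))\big)=0,$$ where $f_k^+:Q\to Q$ is the map implicitly defined by $f^{+}_{k}(q)=D_{2}H_{\rm d}^{+}\big(q,DS_{\rm d}^{k+1}(f^{+}_{k}(q))\big)$. Let $\{c_k\}_{k=0}^{N}\subset Q$ be a set of points such that $c_{k+1}=f_k^{+}(c_k)$ for $k=0,1,\dots,N-1$. Then the set of points $\{(c_k,p_k)\}_{k=0}^{N}\subset T^*Q$ with $p_k:=DS_{\rm d}^{k}(c_k)$ is a solution of the right discrete Hamilton's equations $$c_{k+1}=D_2H_{\rm d}^{+}(c_k,p_{k+1}),\qquad p_k=D_1H_{\rm d}^{+}(c_k,p_{k+1}),\qquad k=0,\dots,N-1.$$ (2) Let $H_{\rm d}^{-}$ be a left discrete Hamiltonian and suppose that $\{S_{\rm d}^k\}$ satisfies the left discrete Hamilton--Jacobi equation: for all $k=0,\dots,N-1$ and $q\in Q$, $$S_{\rm d}^{k+1}(f^{-}_{k}(q))-S_{\rm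 d}^{k}(q)+DS_{\rm d}^{k}(q)\cdot q+H_{\rm d}^{-}\big(DS_{\rm d}^{k}(q),f^{-}_{k}(q)\big)=0,$$ where $f_k^-:Q\to Q$ is the map implicitly defined by $q=-D_{1}H_{\rm d}^{-}\big(DS_{\rm d}^{k}(q),f^{-}_{k}(q)\big)$. Let $\{c_k\}_{k=0}^{N}\subset Q$ be a set of points such that $c_{k+1}=f_k^{-}(c_k)$ for $k=0,1,\dots,N-1$, and assume that the Jacobian $Df_k^{-}$ is invertible at each point $c_k$ ($k=0,\dots,N-1$). Then the set of points $\{(c_k,p_k)\}_{k=0}^{N}\subset T^*Q$ with $p_k:=DS_{\rm d}^{k}(c_k)$ is a solution of the left discrete Hamilton's equations $$c_k=-D_1H_{\rm d}^{-}(p_k,c_{k+1}),\qquad p_{k+1}=-D_2H_{\rm d}^{-}(p_k,c_{k+1}),\qquad k=0,\dots,N-1.$$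
   Context: All formulas are written in coordinates on the $n$-dimensional configuration space $Q$, treated as an open subset of $\mathbb{R}^n$, with $T^*Q=Q\times\mathbb{R}^n$; $\cdot$ is the pairing of covectors and vectors, $D_i$ is the derivative in the $i$-th argument, $D$ the derivative of a function of one argument. A right discrete Hamiltonian is a smooth function $H_{\rm d}^{+}:Q\times\mathbb{R}^n\to\mathbb{R}$, $(q_k,p_{k+1})\mapsto H_{\rm d}^{+}(q_k,p_{k+1})$; a left discrete Hamiltonian is a smooth function $H_{\rm d}^{-}:\mathbb{R}^n\times Q\to\mathbb{R}$, $(p_k,q_{k+1})\mapsto H_{\rm d}^{-}(p_k,q_{k+1})$. The implicit equations defining $f_k^{+}$ (respectively $f_k^{-}$) are assumed to be solvable and to define smooth maps $Q\to Q$. (Equivalently, $f_k^-(q)$ is the base point of the image of $(q,DS_{\rm d}^k(q))$ under the discrete Hamiltonian map $(q_k,p_k)\mapsto(q_{k+1},p_{k+1})$ determined by the left discrete Hamilton's equations.) *)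

theory Defs
  imports "HOL-Analysis.Analysis"
begin

text \<open>
  \<open>C\<^sup>k\<close> and smooth functions on an open set. The recursion runs over
  directional derivatives; since the domain is finite-dimensional, continuity of all
  of them is continuity of the Frechet derivative.
\<close>

primrec Ck_on :: "nat \<Rightarrow> 'a::euclidean_space set \<Rightarrow> ('a \<Rightarrow> 'b::real_normed_vector) \<Rightarrow> bool" where
  "Ck_on 0 A f \<longleftrightarrow> continuous_on A f"
| "Ck_on (Suc k) A f \<longleftrightarrow> (\<forall>x\<in>A. f differentiable (at x)) \<and>
     (\<forall>v. Ck_on k A (\<lambda>x. frechet_derivative f (at x) v))"

definition smooth_on :: "'a::euclidean_space set \<Rightarrow> ('a \<Rightarrow> 'b::real_normed_vector) \<Rightarrow> bool" where
  "smooth_on A f \<longleftrightarrow> (\<forall>k. Ck_on k A f)"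

text \<open>
  Covectors are represented by their components, so that the cotangent bundle of
  \<open>Q\<close> is \<open>Q \<times> UNIV\<close> and the pairing of a covector with a vector is the
  inner product. The derivative of a scalar function is its vector of partial
  derivatives. For a function on pairs, \<open>D1\<close> and \<open>D2\<close> are the derivatives in
  the first and in the second argument.
\<close>

definition D :: "(real^'n \<Rightarrow> real) \<Rightarrow> real^'n \<Rightarrow> real^'n" where
  "D g x = (\<chi> i. frechet_derivative g (at x) (axis i 1))"

definition D1 :: "((real^'n) \<times> (real^'n) \<Rightarrow> real) \<Rightarrow> real^'n \<Rightarrow> real^'n \<Rightarrow> real^'n" where
  "D1 H x y = D (\<lambda>x'. H (x', y)) x"

definition D2 :: "((real^'n) \<times> (real^'n) \<Rightarrow> real) \<Rightarrow> real^'n \<Rightarrow> real^'n \<Rightarrow> real^'n" where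
  "D2 H x y = D (\<lambda>y'. H (x, y')) y"

definition right_discrete_Hamiltonian ::
    "(real^'n) set \<Rightarrow> ((real^'n) \<times> (real^'n) \<Rightarrow> real) \<Rightarrow> bool" where
  "right_discrete_Hamiltonian Q H \<longleftrightarrow> smooth_on (Q \<times> UNIV) H"

definition left_discrete_Hamiltonian ::
    "(real^'n) set \<Rightarrow> ((real^'n) \<times> (real^'n) \<Rightarrow> real) \<Rightarrow> bool" where
  "left_discrete_Hamiltonian Q H \<longleftrightarrow> smooth_on (UNIV \<times> Q) H"

text \<open>
  In the next two definitions, \<open>S\<close> stands for \<open>S\<^sub>d\<^sup>k\<^sup>+\<^sup>1\<close> in the right
  and for \<open>S\<^sub>d\<^sup>k\<close> in the left case. The map \<open>f\<close> is required to be a smooth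
  solution of the implicit equation; it is not required to be the only one.
\<close>

definition right_implicit_map ::
    "(real^'n) set \<Rightarrow> ((real^'n) \<times> (real^'n) \<Rightarrow> real) \<Rightarrow> (real^'n \<Rightarrow> real) \<Rightarrow>
     (real^'n \<Rightarrow> real^'n) \<Rightarrow> bool" where
  "right_implicit_map Q H S f \<longleftrightarrow> f \<in> Q \<rightarrow> Q \<and> smooth_on Q f \<and>
     (\<forall>q\<in>Q. f q = D2 H q (D S (f q)))"

definition left_implicit_map ::
    "(real^'n) set \<Rightarrow> ((real^'n) \<times> (real^'n) \<Rightarrow> real) \<Rightarrow> (real^'n \<Rightarrow> real) \<Rightarrow>
     (real^'n \<Rightarrow> real^'n) \<Rightarrow> bool" where
  "left_implicit_map Q H S f \<longleftrightarrow> f \<in> Q \<rightarrow> Q \<and> smooth_on Q f \<and>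
     (\<forall>q\<in>Q. q = - D1 H (D S q) (f q))"

definition right_discrete_HJ ::
    "(real^'n) set \<Rightarrow> nat \<Rightarrow> ((real^'n) \<times> (real^'n) \<Rightarrow> real) \<Rightarrow> (nat \<Rightarrow> real^'n \<Rightarrow> real) \<Rightarrow>
     (nat \<Rightarrow> real^'n \<Rightarrow> real^'n) \<Rightarrow> bool" where
  "right_discrete_HJ Q N H S f \<longleftrightarrow> (\<forall>k<N. \<forall>q\<in>Q.
     S (Suc k) (f k q) - S k q - D (S (Suc k)) (f k q) \<bullet> f k q
       + H (q, D (S (Suc k)) (f k q)) = 0)"

definition left_discrete_HJ ::
    "(real^'n) set \<Rightarrow> nat \<Rightarrow> ((real^'n) \<times> (real^'n) \<Rightarrow> real) \<Rightarrow> (nat \<Rightarrow> real^'n \<Rightarrow> real) \<Rightarrow>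
     (nat \<Rightarrow> real^'n \<Rightarrow> real^'n) \<Rightarrow> bool" where
  "left_discrete_HJ Q N H S f \<longleftrightarrow> (\<forall>k<N. \<forall>q\<in>Q.
     S (Suc k) (f k q) - S k q + D (S k) q \<bullet> q + H (D (S k) q, f k q) = 0)"

definition right_discrete_Hamilton_solution ::
    "(real^'n) set \<Rightarrow> nat \<Rightarrow> ((real^'n) \<times> (real^'n) \<Rightarrow> real) \<Rightarrow>
     (nat \<Rightarrow> (real^'n) \<times> (real^'n)) \<Rightarrow> bool" where
  "right_discrete_Hamilton_solution Q N H z \<longleftrightarrow>
     (\<forall>k\<le>N. z k \<in> Q \<times> UNIV) \<and>
     (\<forall>k<N. fst (z (Suc k)) = D2 H (fst (z k)) (snd (z (Suc k))) \<and>
            snd (z k) = D1 H (fst (z k)) (snd (z (Suc k))))"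

definition left_discrete_Hamilton_solution ::
    "(real^'n) set \<Rightarrow> nat \<Rightarrow> ((real^'n) \<times> (real^'n) \<Rightarrow> real) \<Rightarrow>
     (nat \<Rightarrow> (real^'n) \<times> (real^'n)) \<Rightarrow> bool" where
  "left_discrete_Hamilton_solution Q N H z \<longleftrightarrow>
     (\<forall>k\<le>N. z k \<in> Q \<times> UNIV) \<and>
     (\<forall>k<N. fst (z k) = - D1 H (snd (z k)) (fst (z (Suc k))) \<and>
            snd (z (Suc k)) = - D2 H (snd (z k)) (fst (z (Suc k))))"

end

theory Submission
  imports Defs
begin

text \<open>
  Differentiate the Hamilton--Jacobi equation with respect to \<open>q\<close>; write \<open>S\<close>, \<open>S'\<close> for the
  functions with index \<open>k\<close>, \<open>k + 1\<close>. The implicit equation for \<open>f\<close> cancels every term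
  containing a second derivative of \<open>S\<close> or \<open>S'\<close>. In the right case the terms containing \<open>Df\<close>
  cancel too, leaving \<open>DS(q) = D\<^sub>1H(q, DS'(f(q)))\<close>. In the left case one is left with
  \<open>(DS'(f(q)) + D\<^sub>2H(DS(q), f(q))) \<bullet> Df(q)h = 0\<close> for all \<open>h\<close>, and invertibility of \<open>Df(q)\<close>
  finishes.
\<close>

lemma smooth_on_imp_differentiable:
  assumes "smooth_on A f" and "x \<in> A"
  shows "f differentiable (at x)"
  using assms unfolding smooth_on_def by (metis Ck_on.simps(2))

lemma smooth_on_frechet_derivative:
  assumes "smooth_on A f"
  shows "smooth_on A (\<lambda>x. frechet_derivative f (at x) v)"
  using assms unfolding smooth_on_def by (metis Ck_on.simps(2))

text \<open>A linear functional is determined by its values on the vectors \<open>axis i 1\<close>,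
  and these values are the components of \<open>D g x\<close>. Besides total derivatives, this also
  identifies the partial ones below.\<close>

lemma has_derivative_D:
  assumes "(g has_derivative g') (at x)"
  shows "g' h = D g x \<bullet> h"
proof -
  interpret g': bounded_linear g' by (rule has_derivative_bounded_linear[OF assms])
  have eq: "frechet_derivative g (at x) = g'"
    using frechet_derivative_at[OF assms] by simp
  have "g' h = g' (\<Sum>i\<in>UNIV. h $ i *\<^sub>R axis i 1)"
    by (simp add: basis_expansion flip: scalar_mult_eq_scaleR)
  also have "\<dots> = (\<Sum>i\<in>UNIV. h $ i * g' (axis i 1))"
    by (simp add: g'.sum g'.scaleR)
  also have "\<dots> = D g x \<bullet> h"
    by (simp add: D_def eq inner_vec_def mult.commute)
  finally show ?thesis .
qed

lemma differentiable_has_derivative_D: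
  assumes "g differentiable (at x)"
  shows "(g has_derivative (\<lambda>h. D g x \<bullet> h)) (at x)"
proof -
  from assms obtain g' where g': "(g has_derivative g') (at x)"
    unfolding differentiable_def by blast
  have "g' = (\<lambda>h. D g x \<bullet> h)"
    using has_derivative_D[OF g'] by blast
  with g' show ?thesis by simp
qed

text \<open>Composing \<open>H\<close> with the embeddings \<open>x' \<mapsto> (x', y)\<close> and
  \<open>y' \<mapsto> (x, y')\<close> restricts \<open>H'\<close> to the two axes; additivity of
  \<open>H'\<close> on \<open>(fst h, 0) + (0, snd h)\<close> recovers all of it.\<close>

lemma differentiable_has_derivative_D1_D2:
  assumes "H differentiable (at (x, y))"
  shows "(H has_derivative (\<lambda>h. D1 H x y \<bullet> fst h + D2 H x y \<bullet> snd h)) (at (x, y))"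
proof -
  from assms obtain H' where H': "(H has_derivative H') (at (x, y))"
    unfolding differentiable_def by blast
  interpret H': bounded_linear H' by (rule has_derivative_bounded_linear[OF H'])
  have "((\<lambda>x'. H (x', y)) has_derivative (\<lambda>h. H' (h, 0))) (at x)"
    by (rule has_derivative_compose[where g = H and f = "\<lambda>x'. (x', y)", OF _ H'])
      (auto intro!: derivative_eq_intros)
  then have 1: "H' (h, 0) = D1 H x y \<bullet> h" for h
    unfolding D1_def by (rule has_derivative_D)
  have "((\<lambda>y'. H (x, y')) has_derivative (\<lambda>h. H' (0, h))) (at y)"
    by (rule has_derivative_compose[where g = H and f = "\<lambda>y'. (x, y')", OF _ H'])
      (auto intro!: derivative_eq_intros)
  then have 2: "H' (0, h) = D2 H x y \<bullet> h" for h
    unfolding D2_def by (rule has_derivative_D)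
  have "H' h = D1 H x y \<bullet> fst h + D2 H x y \<bullet> snd h" for h
    using H'.add[of "(fst h, 0)" "(0, snd h)"] 1 2 by simp
  then have "H' = (\<lambda>h. D1 H x y \<bullet> fst h + D2 H x y \<bullet> snd h)" by blast
  with H' show ?thesis by simp
qed

text \<open>The components of \<open>D g\<close> are directional derivatives of \<open>g\<close>,
  hence smooth again. This is where second-order smoothness enters: the momentum terms of the
  Hamilton--Jacobi equation become differentiable.\<close>

lemma smooth_on_D_differentiable:
  assumes "smooth_on A g" and "x \<in> A"
  shows "D g differentiable (at x)"
proof -
  have "(\<lambda>x. D g x \<bullet> b) differentiable (at x)" if "b \<in> Basis" for b
  proof -
    from that obtain i where b: "b = axis i 1" by (auto simp: Basis_vec_def)
    show ?thesis
      using smooth_on_imp_differentiable[OF smooth_on_frechet_derivative[OF assms(1)] assms(2)]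
      by (simp add: b D_def inner_axis)
  qed
  then show ?thesis
    by (subst differentiable_componentwise_within) simp
qed

text \<open>The Hamilton--Jacobi equation holds on \<open>Q\<close> only; openness makes its
  left-hand side agree with zero near the point, and derivatives are unique.\<close>

lemma has_derivative_zero_on_open:
  fixes F :: "'a::real_normed_vector \<Rightarrow> real"
  assumes "(F has_derivative F') (at x)" and "open A" and "x \<in> A" and "\<And>y. y \<in> A \<Longrightarrow> F y = 0"
  shows "F' h = 0"
proof -
  have "((\<lambda>_. 0) has_derivative F') (at x)"
    using has_derivative_transform_within_open[OF assms(1-3), of "\<lambda>_. 0"] assms(4) by simp
  then have "F' = (\<lambda>_. 0)"
    using has_derivative_unique has_derivative_const by blast
  then show ?thesis by simp
qed

lemma invertible_jacobian_orthogonal: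
  fixes f :: "real^'n \<Rightarrow> real^'n"
  assumes f: "(f has_derivative f') (at x)" and inv: "invertible (jacobian f (at x))"
    and orth: "\<And>h. v \<bullet> f' h = 0"
  shows "v = 0"
proof -
  have "jacobian f (at x) = matrix f'"
    using frechet_derivative_at[OF f] by (simp add: jacobian_def)
  then have "jacobian f (at x) *v h = f' h" for h
    using matrix_works has_derivative_linear[OF f] by (simp add: linear_matrix_vector_mul_eq)
  \<comment> \<open>The right inverse supplies a preimage \<open>B *v v\<close> of \<open>v\<close>
    under \<open>f'\<close>; testing orthogonality on it gives
    \<open>v \<bullet> v = 0\<close>.\<close>
  moreover obtain B where "jacobian f (at x) ** B = mat 1"
    using inv unfolding invertible_def by blast
  then have "jacobian f (at x) *v (B *v v) = v"
    by (simp add: matrix_vector_mul_assoc)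
  ultimately have "f' (B *v v) = v" by simp
  with orth[of "B *v v"] show ?thesis by simp
qed

lemma right_HJ_derivative:
  fixes H :: "(real^'n) \<times> (real^'n) \<Rightarrow> real"
  assumes Q: "open Q" "q \<in> Q" and S: "smooth_on Q S" and S': "smooth_on Q S'"
    and H: "right_discrete_Hamiltonian Q H" and f: "right_implicit_map Q H S' f"
    and HJ: "\<And>q. q \<in> Q \<Longrightarrow> S' (f q) - S q - D S' (f q) \<bullet> f q + H (q, D S' (f q)) = 0"
  shows "D S q = D1 H q (D S' (f q))"
proof -
  from f Q have fq: "f q \<in> Q" "f q = D2 H q (D S' (f q))" and fs: "smooth_on Q f"
    by (auto simp: right_implicit_map_def)
  from smooth_on_imp_differentiable[OF fs Q(2)] obtain f'
    where f': "(f has_derivative f') (at q)" unfolding differentiable_def by blast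
  from smooth_on_D_differentiable[OF S' fq(1)] obtain G
    where G: "(D S' has_derivative G) (at (f q))" unfolding differentiable_def by blast
  have P: "((\<lambda>q. D S' (f q)) has_derivative (\<lambda>h. G (f' h))) (at q)"
    by (rule has_derivative_compose[OF f' G])
  have dS: "(S has_derivative (\<lambda>h. D S q \<bullet> h)) (at q)"
    by (rule differentiable_has_derivative_D[OF smooth_on_imp_differentiable[OF S Q(2)]])
  have dS': "((\<lambda>q. S' (f q)) has_derivative (\<lambda>h. D S' (f q) \<bullet> f' h)) (at q)"
    by (rule has_derivative_compose[OF f'
        differentiable_has_derivative_D[OF smooth_on_imp_differentiable[OF S' fq(1)]]])
  have "H differentiable (at (q, D S' (f q)))"
    using H Q(2) by (auto simp: right_discrete_Hamiltonian_def intro: smooth_on_imp_differentiable)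
  from has_derivative_compose[OF has_derivative_Pair[OF has_derivative_ident P]
      differentiable_has_derivative_D1_D2[OF this]]
  \<comment> \<open>The factor \<open>D2 H q (D S' (f q))\<close> from the chain rule is already
    replaced by \<open>f q\<close>, so that the term with \<open>G\<close>, the second derivative of
    \<open>S'\<close>, can cancel.\<close>
  have dH: "((\<lambda>q. H (q, D S' (f q))) has_derivative
      (\<lambda>h. D1 H q (D S' (f q)) \<bullet> h + f q \<bullet> G (f' h))) (at q)"
    by (simp flip: fq(2))
  \<comment> \<open>The bracket that is subtracted is the product rule for the pairing: its first
    term cancels the derivative of \<open>S' (f q)\<close>, its second the \<open>G\<close> term of
    \<open>dH\<close>.\<close>
  have "D S' (f q) \<bullet> f' h - D S q \<bullet> h - (D S' (f q) \<bullet> f' h + G (f' h) \<bullet> f q)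
      + (D1 H q (D S' (f q)) \<bullet> h + f q \<bullet> G (f' h)) = 0" for h
    by (rule has_derivative_zero_on_open[OF
          has_derivative_add[OF has_derivative_diff[OF has_derivative_diff[OF dS' dS]
            has_derivative_inner[OF P f']] dH] Q HJ])
  then have "D S q \<bullet> h = D1 H q (D S' (f q)) \<bullet> h" for h
    by (smt (verit) inner_commute)
  then show ?thesis by (metis vector_eq_rdot)
qed

text \<open>Unlike in the right case, the pairing is with \<open>q\<close> itself, so its derivative
  contains no \<open>f'\<close> to offset those from \<open>S' (f q)\<close> and from the second
  argument of \<open>H\<close>. The covector multiplying \<open>f' h\<close> must then be shown to
  vanish, which is why the Jacobian has to be invertible at \<open>q\<close>.\<close>

lemma left_HJ_derivative:
  fixes H :: "(real^'n) \<times> (real^'n) \<Rightarrow> real"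
  assumes Q: "open Q" "q \<in> Q" and S: "smooth_on Q S" and S': "smooth_on Q S'"
    and H: "left_discrete_Hamiltonian Q H" and f: "left_implicit_map Q H S f"
    and HJ: "\<And>q. q \<in> Q \<Longrightarrow> S' (f q) - S q + D S q \<bullet> q + H (D S q, f q) = 0"
    and inv: "invertible (jacobian f (at q))"
  shows "D S' (f q) = - D2 H (D S q) (f q)"
proof -
  from f Q have fq: "f q \<in> Q" "q = - D1 H (D S q) (f q)" and fs: "smooth_on Q f"
    by (auto simp: left_implicit_map_def)
  from smooth_on_imp_differentiable[OF fs Q(2)] obtain f'
    where f': "(f has_derivative f') (at q)" unfolding differentiable_def by blast
  from smooth_on_D_differentiable[OF S Q(2)] obtain G
    where P: "(D S has_derivative G) (at q)" unfolding differentiable_def by blast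
  have dS: "(S has_derivative (\<lambda>h. D S q \<bullet> h)) (at q)"
    by (rule differentiable_has_derivative_D[OF smooth_on_imp_differentiable[OF S Q(2)]])
  have dS': "((\<lambda>q. S' (f q)) has_derivative (\<lambda>h. D S' (f q) \<bullet> f' h)) (at q)"
    by (rule has_derivative_compose[OF f'
        differentiable_has_derivative_D[OF smooth_on_imp_differentiable[OF S' fq(1)]]])
  have "H differentiable (at (D S q, f q))"
    using H fq(1) by (auto simp: left_discrete_Hamiltonian_def intro: smooth_on_imp_differentiable)
  from has_derivative_compose[OF has_derivative_Pair[OF P f']
      differentiable_has_derivative_D1_D2[OF this]]
  have dH: "((\<lambda>q. H (D S q, f q)) has_derivative
      (\<lambda>h. D1 H (D S q) (f q) \<bullet> G h + D2 H (D S q) (f q) \<bullet> f' h)) (at q)"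
    by simp
  have "D S' (f q) \<bullet> f' h - D S q \<bullet> h + (D S q \<bullet> h + G h \<bullet> q)
      + (D1 H (D S q) (f q) \<bullet> G h + D2 H (D S q) (f q) \<bullet> f' h) = 0" for h
    by (rule has_derivative_zero_on_open[OF
          has_derivative_add[OF has_derivative_add[OF has_derivative_diff[OF dS' dS]
            has_derivative_inner[OF P has_derivative_ident]] dH] Q HJ])
  \<comment> \<open>By the implicit equation \<open>D1 H (D S q) (f q)\<close> is \<open>-q\<close>,
    which removes the second derivative \<open>G\<close> of \<open>S\<close>.\<close>
  moreover have "D1 H (D S q) (f q) \<bullet> G h = - (G h \<bullet> q)" for h
    using fq(2) by (metis inner_commute inner_minus_left minus_minus)
  ultimately have "(D S' (f q) + D2 H (D S q) (f q)) \<bullet> f' h = 0" for h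
    by (simp add: inner_add_left)
  from invertible_jacobian_orthogonal[OF f' inv this] show ?thesis
    by (simp add: eq_neg_iff_add_eq_0)
qed

theorem theorem4p1:
  fixes Q :: "(real^'n) set" and N :: nat and S :: "nat \<Rightarrow> real^'n \<Rightarrow> real"
  assumes "open Q" and "N \<ge> 1" and "\<And>k. k \<le> N \<Longrightarrow> smooth_on Q (S k)"
  shows
    "(\<forall>(H :: (real^'n) \<times> (real^'n) \<Rightarrow> real) (f :: nat \<Rightarrow> real^'n \<Rightarrow> real^'n) (c :: nat \<Rightarrow> real^'n).
        right_discrete_Hamiltonian Q H \<longrightarrow>
        (\<forall>k<N. right_implicit_map Q H (S (Suc k)) (f k)) \<longrightarrow>
        right_discrete_HJ Q N H S f \<longrightarrow>
        (\<forall>k\<le>N. c k \<in> Q) \<longrightarrow>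
        (\<forall>k<N. c (Suc k) = f k (c k)) \<longrightarrow>
        right_discrete_Hamilton_solution Q N H (\<lambda>k. (c k, D (S k) (c k))))
     \<and>
     (\<forall>(H :: (real^'n) \<times> (real^'n) \<Rightarrow> real) (f :: nat \<Rightarrow> real^'n \<Rightarrow> real^'n) (c :: nat \<Rightarrow> real^'n).
        left_discrete_Hamiltonian Q H \<longrightarrow>
        (\<forall>k<N. left_implicit_map Q H (S k) (f k)) \<longrightarrow>
        left_discrete_HJ Q N H S f \<longrightarrow>
        (\<forall>k\<le>N. c k \<in> Q) \<longrightarrow>
        (\<forall>k<N. c (Suc k) = f k (c k)) \<longrightarrow>
        (\<forall>k<N. invertible (jacobian (f k) (at (c k)))) \<longrightarrow>
        left_discrete_Hamilton_solution Q N H (\<lambda>k. (c k, D (S k) (c k))))"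
proof (intro conjI allI impI)
  fix H :: "(real^'n) \<times> (real^'n) \<Rightarrow> real" and f :: "nat \<Rightarrow> real^'n \<Rightarrow> real^'n" and c :: "nat \<Rightarrow> real^'n"
  assume H: "right_discrete_Hamiltonian Q H"
    and f: "\<forall>k<N. right_implicit_map Q H (S (Suc k)) (f k)"
    and HJ: "right_discrete_HJ Q N H S f"
    and c: "\<forall>k\<le>N. c k \<in> Q" "\<forall>k<N. c (Suc k) = f k (c k)"
  have "D (S k) (c k) = D1 H (c k) (D (S (Suc k)) (f k (c k)))" if "k < N" for k
    by (rule right_HJ_derivative[where f = "f k", OF assms(1) _ _ _ H])
      (use that f HJ c assms(3) in \<open>auto simp: right_discrete_HJ_def\<close>)
  \<comment> \<open>The other Hamilton equation is the implicit equation at \<open>c k\<close>: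
    since \<open>f k (c k)\<close> is \<open>c (Suc k)\<close>, its momentum argument is the one
    with index \<open>Suc k\<close>.\<close>
  moreover have "f k (c k) = D2 H (c k) (D (S (Suc k)) (f k (c k)))" if "k < N" for k
    using that f c(1) by (simp add: right_implicit_map_def)
  ultimately show "right_discrete_Hamilton_solution Q N H (\<lambda>k. (c k, D (S k) (c k)))"
    using c by (simp add: right_discrete_Hamilton_solution_def)
next
  fix H :: "(real^'n) \<times> (real^'n) \<Rightarrow> real" and f :: "nat \<Rightarrow> real^'n \<Rightarrow> real^'n" and c :: "nat \<Rightarrow> real^'n"
  assume H: "left_discrete_Hamiltonian Q H"
    and f: "\<forall>k<N. left_implicit_map Q H (S k) (f k)"
    and HJ: "left_discrete_HJ Q N H S f"
    and c: "\<forall>k\<le>N. c k \<in> Q" "\<forall>k<N. c (Suc k) = f k (c k)"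
    and inv: "\<forall>k<N. invertible (jacobian (f k) (at (c k)))"
  \<comment> \<open>The momentum at \<open>Suc k\<close> is obtained by differentiating at
    \<open>c k\<close>, so the Jacobian is inverted at the points with \<open>k < N\<close>.\<close>
  have "D (S (Suc k)) (f k (c k)) = - D2 H (D (S k) (c k)) (f k (c k))" if "k < N" for k
    by (rule left_HJ_derivative[where f = "f k", OF assms(1) _ _ _ H])
      (use that f HJ c inv assms(3) in \<open>auto simp: left_discrete_HJ_def\<close>)
  moreover have "c k = - D1 H (D (S k) (c k)) (f k (c k))" if "k < N" for k
    using that f c(1) unfolding left_implicit_map_def by (meson less_imp_le)
  ultimately show "left_discrete_Hamilton_solution Q N H (\<lambda>k. (c k, D (S k) (c k)))"
    using c by (simp add: left_discrete_Hamilton_solution_def)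
qed

end
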